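(* Let $k=\omega(1)$, let $d\le k$, and let $G$ be a graph on more than $k$ vertices such that every $S\subseteq V(G)$ with $|S|\le k$ satisfies $\partial_G(S)\ge d|S|$. Let $\epsilon>0$ be a sufficiently small constant and let $p=\frac{1+\epsilon}{d}$. Then, with probability tending to $1$ as $k\to\infty$, $G_p$ contains a component of order at least $\frac{k}{2}$.
   Context: $G_p$ denotes the random subgraph of $G$ obtained by retaining each edge independently with probability $p$. For $S\subseteq V(G)$, $\partial_G(S)$ is the number of edges of $G$ with exactly one endpoint in $S$. ($G$ need not be regular; $d$ is a parameter.) *)

theory Defs
  imports "HOL-Probability.Probability" "HOL-Probability.Product_PMF"
begin

definition simple_graph :: "'a set \<Rightarrow> 'a set set \<Rightarrow> bool" where
  "simple_graph V E \<longleftrightarrow> finite V \<and> (\<forall>e\<in>E. e \<subseteq> V \<and> card e = 2)"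

definition edge_boundary :: "'a set set \<Rightarrow> 'a set \<Rightarrow> nat" where
  "edge_boundary E S = card {e \<in> E. card (e \<inter> S) = 1}"

definition connected_in :: "'a set set \<Rightarrow> ('a \<times> 'a) set" where
  "connected_in E = {(u, v). {u, v} \<in> E}\<^sup>*"

definition component_sets :: "'a set \<Rightarrow> 'a set set \<Rightarrow> 'a set set" where
  "component_sets V E = (\<lambda>v. {w \<in> V. (v, w) \<in> connected_in E}) ` V"

text \<open>The law of the edge set of \<open>G\<^sub>p\<close>, whose vertex set is that of \<open>G\<close>. The library's
  \<^const>\<open>bernoulli_pmf\<close> truncates its parameter to the unit interval, so every edge is
  retained when \<open>p \<ge> 1\<close>.\<close>

definition percolation :: "'a set set \<Rightarrow> real \<Rightarrow> 'a set set pmf" where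
  "percolation E p =
     map_pmf (\<lambda>f. {e \<in> E. f e}) (Pi_pmf E False (\<lambda>_. bernoulli_pmf p))"

end

theory Submission
  imports Defs "HOL-Real_Asymp.Real_Asymp"
begin

text \<open>For a fixed vertex set \<open>A\<close> let \<open>R\<close> be the set reached from \<open>A\<close> in \<open>G\<^sub>p\<close>. Revealing one by one
  the edges that leave the currently reached set shows that
  \<open>x ^ |R| * y ^ \<partial>R\<close> has expectation at most \<open>x ^ |A|\<close> whenever \<open>y * (1 - p + p * x) \<le> 1\<close> and
  \<open>x \<le> 1 \<le> y\<close>: each success adds a vertex, and the boundary edges of \<open>R\<close> are all failures. With
  \<open>x = exp (-\<epsilon>)\<close>, \<open>y = exp (p * (1 - x))\<close> and the isoperimetric hypothesis, Markov's inequality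
  makes \<open>k / 2 \<le> |R| \<le> k\<close> exponentially unlikely. Apply this to all initial segments \<open>A\<close> of length at
  most \<open>\<lceil>k / 2\<rceil>\<close> of an enumeration of the vertices: at the first segment with \<open>|R| \<ge> k / 2\<close> the set
  \<open>R\<close> jumps from below \<open>k / 2\<close> to above \<open>k\<close>, and the jump is due to a single component.\<close>

lemma percolation_insert:
  assumes "finite E" "e \<notin> E"
  shows "percolation (insert e E) p =
    bind_pmf (bernoulli_pmf p) (\<lambda>b. map_pmf (\<lambda>F. if b then insert e F else F) (percolation E p))"
proof -
  have "{e' \<in> insert e E. (f(e := b)) e'} =
      (if b then insert e {e' \<in> E. f e'} else {e' \<in> E. f e'})" for f b
    using assms(2) by auto
  then show ?thesis
    unfolding percolation_def Pi_pmf_insert'[OF assms]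
    by (simp add: map_bind_pmf bind_return_pmf map_pmf_def bind_assoc_pmf)
qed

lemma set_pmf_percolation_subset:
  assumes "finite E"
  shows "set_pmf (percolation E p) \<subseteq> Pow E"
  unfolding percolation_def by auto

lemma percolation_ge_1:
  assumes "finite E" "1 \<le> p"
  shows "percolation E p = return_pmf E"
proof -
  have "bernoulli_pmf p = return_pmf True"
    using assms(2) by (intro pmf_eqI) (simp add: bernoulli_pmf.rep_eq split: bool.split)
  then show ?thesis
    using assms(1) by (simp add: percolation_def Pi_pmf_return_pmf)
qed

lemma reach_insert_edge:
  assumes "u \<in> A"
  shows "connected_in (insert {u, v} F) `` A = connected_in F `` insert v A"
proof -
  let ?r = "{(a, b). {a, b} \<in> F}" and ?s = "{(a, b). {a, b} \<in> insert {u, v} F}"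
  have uv: "u \<in> ?r\<^sup>* `` insert v A" "v \<in> ?r\<^sup>* `` insert v A"
    using assms by auto
  have "w \<in> ?r\<^sup>* `` insert v A" if "(a, w) \<in> ?s\<^sup>*" "a \<in> A" for a w
    using that
  proof (induction rule: rtrancl_induct)
    case base
    then show ?case by auto
  next
    case (step y z)
    from step.hyps(2) have "(y, z) \<in> ?r \<or> z = u \<or> z = v"
      by (auto simp: doubleton_eq_iff)
    then show ?case
      using step.IH[OF step.prems] uv by (auto intro: rtrancl_into_rtrancl)
  qed
  moreover have "w \<in> ?s\<^sup>* `` A" if "(a, w) \<in> ?r\<^sup>*" "a \<in> insert v A" for a w
  proof -
    have "(a, w) \<in> ?s\<^sup>*"
      using that(1) rtrancl_mono[of ?r ?s] by auto
    moreover have "(u, v) \<in> ?s\<^sup>*"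
      by auto
    ultimately show ?thesis
      using that(2) assms by (auto intro: rtrancl_trans)
  qed
  ultimately show ?thesis
    unfolding connected_in_def by blast
qed

lemma subset_reach: "A \<subseteq> connected_in F `` A"
  unfolding connected_in_def by auto

lemma reach_subset:
  assumes "A \<subseteq> B" "\<And>a b. a \<in> B \<Longrightarrow> {a, b} \<in> F \<Longrightarrow> b \<in> B"
  shows "connected_in F `` A \<subseteq> B"
proof -
  have "w \<in> B" if "(a, w) \<in> {(u, v). {u, v} \<in> F}\<^sup>*" "a \<in> A" for a w
    using that by (induction rule: rtrancl_induct) (use assms in auto)
  then show ?thesis
    unfolding connected_in_def by auto
qed

lemma reach_closed:
  assumes "a \<in> connected_in F `` A" "{a, b} \<in> F"
  shows "b \<in> connected_in F `` A"
  using assms unfolding connected_in_def by (auto intro: rtrancl_into_rtrancl)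

lemma edge_boundary_eq_0_of_closed:
  assumes "\<forall>e\<in>E. card e = 2" "\<And>a b. a \<in> R \<Longrightarrow> {a, b} \<in> E \<Longrightarrow> b \<in> R"
  shows "edge_boundary E R = 0"
proof -
  have "card (e \<inter> R) \<noteq> 1" if "e \<in> E" for e
  proof -
    have "card e = 2"
      using assms(1) that by blast
    then obtain a b where ab: "e = {a, b}" "a \<noteq> b"
      by (auto simp: card_2_iff)
    then have "a \<in> R \<longleftrightarrow> b \<in> R"
      using assms(2)[of a b] assms(2)[of b a] that by (metis insert_commute)
    then have "e \<inter> R = {} \<or> e \<inter> R = {a, b}"
      using ab by auto
    then show ?thesis
      using ab(2) by auto
  qed
  then have "{e \<in> E. card (e \<inter> R) = 1} = {}"
    by auto
  then show ?thesis
    by (simp only: edge_boundary_def card.empty)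
qed

lemma edge_boundary_insert_inside:
  assumes "u \<in> R" "v \<in> R" "u \<noteq> v"
  shows "edge_boundary (insert {u, v} E) R = edge_boundary E R"
proof -
  have "card ({u, v} \<inter> R) = 2"
    using assms by (simp add: Int_absorb2)
  then have "{e \<in> insert {u, v} E. card (e \<inter> R) = 1} = {e \<in> E. card (e \<inter> R) = 1}"
    by auto
  then show ?thesis
    by (simp add: edge_boundary_def)
qed

lemma edge_boundary_insert_le:
  assumes "finite E"
  shows "edge_boundary (insert e E) R \<le> Suc (edge_boundary E R)"
proof -
  have "edge_boundary (insert e E) R \<le> card (insert e {e \<in> E. card (e \<inter> R) = 1})"
    unfolding edge_boundary_def using assms by (intro card_mono) auto
  also have "\<dots> \<le> Suc (edge_boundary E R)"
    unfolding edge_boundary_def using assms by (simp add: card_insert_if)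
  finally show ?thesis .
qed

lemma reach_weight_le:
  fixes x y p :: real
  assumes "finite E" "\<forall>e\<in>E. card e = 2" "finite A"
    and "0 \<le> p" "p \<le> 1" "0 \<le> x" "x \<le> 1" "1 \<le> y" "y * (1 - p + p * x) \<le> 1"
  shows "(\<integral>\<^sup>+F. ennreal (x ^ card (connected_in F `` A) * y ^ edge_boundary E (connected_in F `` A))
           \<partial>percolation E p) \<le> ennreal (x ^ card A)"
  using assms(1-3)
proof (induction "card E" arbitrary: E A rule: less_induct)
  case less
  let ?w = "\<lambda>E A F. x ^ card (connected_in F `` A) * y ^ edge_boundary E (connected_in F `` A)"
  show ?case
  proof (cases "\<exists>u v. u \<in> A \<and> v \<notin> A \<and> {u, v} \<in> E")
    case False
    have "edge_boundary E A = 0"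
      using less.prems(2) False by (intro edge_boundary_eq_0_of_closed) auto
    moreover have "connected_in F `` A = A" if "F \<subseteq> E" for F
      using reach_subset[of A A F] subset_reach[of A F] False that by blast
    ultimately have "?w E A F = x ^ card A" if "F \<in> set_pmf (percolation E p)" for F
      using that set_pmf_percolation_subset[OF less.prems(1), of p] by auto
    then have "(\<integral>\<^sup>+F. ennreal (?w E A F) \<partial>percolation E p) =
        (\<integral>\<^sup>+F. ennreal (x ^ card A) \<partial>percolation E p)"
      by (intro nn_integral_cong_AE) (simp add: AE_measure_pmf_iff)
    then show ?thesis
      by simp
  next
    case True
    then obtain u v where uv: "u \<in> A" "v \<notin> A" "{u, v} \<in> E" by blast
    define E' where "E' = E - {{u, v}}"
    have E: "E = insert {u, v} E'" "{u, v} \<notin> E'" "finite E'" "card E' < card E"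
      "\<forall>e\<in>E'. card e = 2"
      using uv less.prems card_Diff1_less[of E "{u, v}"] unfolding E'_def by auto
    have "u \<noteq> v" using uv by auto
    have hit: "?w E A (insert {u, v} F) = ?w E' (insert v A) F" for F
    proof -
      have "u \<in> connected_in F `` insert v A" "v \<in> connected_in F `` insert v A"
        using subset_reach[of "insert v A" F] uv by auto
      then show ?thesis
        unfolding reach_insert_edge[OF uv(1)] E(1)
        using edge_boundary_insert_inside[OF _ _ \<open>u \<noteq> v\<close>] by simp
    qed
    have miss: "?w E A F \<le> y * ?w E' A F" for F
    proof -
      have "y ^ edge_boundary E (connected_in F `` A) \<le> y ^ Suc (edge_boundary E' (connected_in F `` A))"
        unfolding E(1) by (intro power_increasing edge_boundary_insert_le E(3) assms)
      then have "x ^ card (connected_in F `` A) * y ^ edge_boundary E (connected_in F `` A) \<le>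
          x ^ card (connected_in F `` A) * y ^ Suc (edge_boundary E' (connected_in F `` A))"
        using assms by (intro mult_left_mono) auto
      then show ?thesis
        by (simp add: mult_ac)
    qed
    have "(\<integral>\<^sup>+F. ennreal (?w E A F) \<partial>percolation E p) =
        ennreal p * (\<integral>\<^sup>+F. ennreal (?w E A (insert {u, v} F)) \<partial>percolation E' p) +
        ennreal (1 - p) * (\<integral>\<^sup>+F. ennreal (?w E A F) \<partial>percolation E' p)"
      unfolding arg_cong[OF E(1), of "\<lambda>E. percolation E p"] percolation_insert[OF E(3,2)]
      using assms by (simp add: nn_integral_bind_pmf mult.commute)
    also have "\<dots> \<le> ennreal p * ennreal (x ^ card (insert v A)) + ennreal (1 - p) * (ennreal y * ennreal (x ^ card A))"
    proof (intro add_mono mult_left_mono)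
      show "(\<integral>\<^sup>+F. ennreal (?w E A (insert {u, v} F)) \<partial>percolation E' p) \<le> ennreal (x ^ card (insert v A))"
        unfolding hit using less.hyps[OF E(4,3,5)] less.prems(3) by simp
      have "(\<integral>\<^sup>+F. ennreal (?w E A F) \<partial>percolation E' p) \<le>
          (\<integral>\<^sup>+F. ennreal y * ennreal (?w E' A F) \<partial>percolation E' p)"
        using assms by (intro nn_integral_mono) (simp add: ennreal_mult'[symmetric] miss ennreal_leI)
      also have "\<dots> = ennreal y * (\<integral>\<^sup>+F. ennreal (?w E' A F) \<partial>percolation E' p)"
        by (simp add: nn_integral_cmult)
      also have "\<dots> \<le> ennreal y * ennreal (x ^ card A)"
        using less.hyps[OF E(4,3,5) less.prems(3)] by (intro mult_left_mono) auto
      finally show "(\<integral>\<^sup>+F. ennreal (?w E A F) \<partial>percolation E' p) \<le> ennreal y * ennreal (x ^ card A)" .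
    qed auto
    also have "\<dots> = ennreal ((p * x + (1 - p) * y) * x ^ card A)"
      using assms uv less.prems
      by (simp add: ennreal_mult'[symmetric] ennreal_plus[symmetric] distrib_right mult.assoc
          del: ennreal_plus)
    also have "\<dots> \<le> ennreal (1 * x ^ card A)"
    proof (intro ennreal_leI mult_right_mono)
      have "p * x * 1 \<le> p * x * y"
        using assms by (intro mult_left_mono) auto
      then show "p * x + (1 - p) * y \<le> 1"
        using assms by (simp add: algebra_simps)
    qed (use assms in auto)
    finally show ?thesis by simp
  qed
qed

lemma prob_reach_medium_le:
  fixes p d k a \<epsilon> :: real
  assumes "finite E" "\<forall>e\<in>E. card e = 2" "finite A"
    and p: "0 \<le> p" "p \<le> 1" "p * d = 1 + \<epsilon>" and \<epsilon>: "0 < \<epsilon>" "\<epsilon> < 1"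
    and iso: "\<And>F. F \<subseteq> E \<Longrightarrow> real (card (connected_in F `` A)) \<le> k \<Longrightarrow>
      d * real (card (connected_in F `` A)) \<le> real (edge_boundary E (connected_in F `` A))"
  shows "measure_pmf.prob (percolation E p)
      {F. a \<le> real (card (connected_in F `` A)) \<and> real (card (connected_in F `` A)) \<le> k}
    \<le> exp (- (\<epsilon>\<^sup>2 * (1 - \<epsilon>) / 2 * a))" (is "measure_pmf.prob _ ?B \<le> exp (- (?c * a))")
proof -
  define x where "x = exp (- \<epsilon>)"
  define y where "y = exp (p * (1 - x))"
  have x: "0 \<le> x" "x \<le> 1" using \<epsilon> by (auto simp: x_def)
  have y: "1 \<le> y" using p x by (simp add: y_def)
  have "1 - p + p * x \<le> exp (- (p * (1 - x)))"
    using exp_ge_add_one_self[of "- (p * (1 - x))"] by (simp add: algebra_simps)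
  then have "y * (1 - p + p * x) \<le> y * exp (- (p * (1 - x)))"
    using y by (intro mult_left_mono) auto
  then have xy: "y * (1 - p + p * x) \<le> 1"
    by (simp add: y_def exp_minus)
  have rate: "?c \<le> (1 + \<epsilon>) * (1 - x) - \<epsilon>"
  proof -
    have "x \<le> 1 - \<epsilon> + \<epsilon>\<^sup>2 / 2"
    proof -
      have "1 \<le> (1 - \<epsilon> + \<epsilon>\<^sup>2 / 2) * (1 + \<epsilon> + \<epsilon>\<^sup>2 / 2)"
        using zero_le_power2[of "\<epsilon>\<^sup>2"] by (simp add: field_simps power2_eq_square)
      also have "\<dots> \<le> (1 - \<epsilon> + \<epsilon>\<^sup>2 / 2) * exp \<epsilon>"
        using \<epsilon> exp_lower_Taylor_quadratic[of \<epsilon>] by (intro mult_left_mono) auto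
      finally show ?thesis
        by (simp add: x_def exp_minus field_simps)
    qed
    then have "(1 + \<epsilon>) * (\<epsilon> - \<epsilon>\<^sup>2 / 2) \<le> (1 + \<epsilon>) * (1 - x)"
      using \<epsilon> by (intro mult_left_mono) auto
    then show ?thesis
      by (simp add: power2_eq_square field_simps)
  qed
  define w where "w F = x ^ card (connected_in F `` A) * y ^ edge_boundary E (connected_in F `` A)" for F
  have w: "exp (?c * a) \<le> w F" if "F \<subseteq> E" "F \<in> ?B" for F
  proof -
    define r where "r = card (connected_in F `` A)"
    define b where "b = edge_boundary E (connected_in F `` A)"
    have ar: "a \<le> real r" and "d * real r \<le> real b"
      using that iso[OF that(1)] by (auto simp: r_def b_def)
    then have "p * (1 - x) * (d * real r) \<le> p * (1 - x) * real b"
      using p x by (intro mult_left_mono) auto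
    moreover have "p * (1 - x) * (d * real r) = (p * d) * (1 - x) * real r"
      by simp
    ultimately have b: "(1 + \<epsilon>) * (1 - x) * real r \<le> p * (1 - x) * real b"
      using p(3) by simp
    have "?c * a \<le> ?c * real r"
      using ar \<epsilon> by (intro mult_left_mono) auto
    also have "\<dots> \<le> ((1 + \<epsilon>) * (1 - x) - \<epsilon>) * real r"
      by (intro mult_right_mono rate) auto
    also have "\<dots> \<le> - \<epsilon> * real r + p * (1 - x) * real b"
      using b by (simp add: algebra_simps)
    finally have "exp (?c * a) \<le> exp (- \<epsilon> * real r + p * (1 - x) * real b)"
      by simp
    also have "\<dots> = x ^ r * y ^ b"
      unfolding exp_add x_def y_def exp_of_nat_mult[symmetric] by (simp add: mult_ac)
    finally show ?thesis
      by (simp add: w_def r_def b_def)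
  qed
  let ?M = "measure_pmf (percolation E p)"
  have "emeasure ?M ?B \<le> (\<integral>\<^sup>+F. ennreal (exp (- (?c * a))) * ennreal (w F) \<partial>?M)"
  proof -
    have "emeasure ?M ?B = (\<integral>\<^sup>+F. indicator ?B F \<partial>?M)"
      by simp
    also have "\<dots> \<le> (\<integral>\<^sup>+F. ennreal (exp (- (?c * a))) * ennreal (w F) \<partial>?M)"
    proof (intro nn_integral_mono_AE, unfold AE_measure_pmf_iff, intro ballI)
      fix F assume "F \<in> set_pmf (percolation E p)"
      then have "F \<subseteq> E"
        using set_pmf_percolation_subset[OF assms(1)] by auto
      then have "1 \<le> exp (- (?c * a)) * w F" if "F \<in> ?B"
        using w[OF _ that] by (simp add: exp_minus field_simps)
      then show "indicator ?B F \<le> ennreal (exp (- (?c * a))) * ennreal (w F)"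
        by (cases "F \<in> ?B") (simp_all add: ennreal_mult'[symmetric] ennreal_leI)
    qed
    finally show ?thesis .
  qed
  also have "\<dots> = ennreal (exp (- (?c * a))) * (\<integral>\<^sup>+F. ennreal (w F) \<partial>?M)"
    by (simp add: nn_integral_cmult)
  also have "\<dots> \<le> ennreal (exp (- (?c * a))) * ennreal (x ^ card A)"
    unfolding w_def using reach_weight_le[OF assms(1-3) p(1,2) x y xy]
    by (intro mult_left_mono) auto
  also have "\<dots> \<le> ennreal (exp (- (?c * a))) * ennreal 1"
    using x by (intro mult_left_mono ennreal_leI power_le_one) auto
  finally have "emeasure ?M ?B \<le> ennreal (exp (- (?c * a)))"
    by simp
  then show ?thesis
    by (simp add: measure_pmf.emeasure_eq_measure)
qed

lemma large_component_of_reach_gap: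
  fixes k :: real
  assumes "finite V" "distinct vs" "set vs = V" "0 < k" "k < real (card V)"
    and F: "\<Union>F \<subseteq> V"
    and gap: "\<And>i. i \<le> nat \<lceil>k / 2\<rceil> \<Longrightarrow>
      \<not> (k / 2 \<le> real (card (connected_in F `` set (take i vs))) \<and>
         real (card (connected_in F `` set (take i vs))) \<le> k)"
  shows "\<exists>C\<in>component_sets V F. k / 2 \<le> real (card C)"
proof -
  let ?m = "nat \<lceil>k / 2\<rceil>" and ?R = "\<lambda>i. connected_in F `` set (take i vs)"
  have RV: "connected_in F `` A \<subseteq> V" if "A \<subseteq> V" for A
    using that F by (intro reach_subset) auto
  have fin: "finite (?R i)" for i
    using RV[of "set (take i vs)"] assms(1,3) set_take_subset[of i vs] by (meson finite_subset)
  have len: "length vs = card V"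
    using assms by (metis distinct_card)
  have "?m \<le> length vs"
    using assms len by linarith
  then have "card (set (take ?m vs)) = ?m"
    using assms(2) by (simp add: distinct_card)
  then have "?m \<le> card (?R ?m)"
    using card_mono[OF fin subset_reach] by metis
  then have ex: "k / 2 \<le> real (card (?R ?m))"
    by linarith
  define i where "i = (LEAST i. k / 2 \<le> real (card (?R i)))"
  have i: "k / 2 \<le> real (card (?R i))" "i \<le> ?m"
    using LeastI[of "\<lambda>i. k / 2 \<le> real (card (?R i))", OF ex]
      Least_le[of "\<lambda>i. k / 2 \<le> real (card (?R i))", OF ex] by (auto simp: i_def)
  have "i \<noteq> 0"
    using i(1) assms(4) by (intro notI) simp
  then obtain j where j: "i = Suc j" by (cases i) auto
  then have small: "real (card (?R j)) < k / 2"
    using not_less_Least[of j "\<lambda>i. k / 2 \<le> real (card (?R i))"] by (simp add: i_def)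
  have jl: "j < length vs"
    using i(2) j \<open>?m \<le> length vs\<close> by linarith
  let ?C = "{w \<in> V. (vs ! j, w) \<in> connected_in F}"
  have vV: "vs ! j \<in> V" using jl assms(3) by auto
  then have C: "connected_in F `` {vs ! j} = ?C"
    using RV[of "{vs ! j}"] by auto
  have "?R i = ?R j \<union> ?C"
    unfolding j take_Suc_conv_app_nth[OF jl] C[symmetric] by auto
  then have "card (?R i) \<le> card (?R j) + card ?C"
    by (simp add: card_Un_le)
  moreover have "k < real (card (?R i))"
    using gap[OF i(2)] i(1) by auto
  ultimately have "k / 2 \<le> real (card ?C)"
    using small by linarith
  then show ?thesis
    using vV unfolding component_sets_def by blast
qed

lemma prob_large_component_ge:
  fixes k d \<epsilon> :: real
  assumes G: "simple_graph V E" "k < real (card V)" and k: "0 < k" and d: "0 < d"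
    and \<epsilon>: "0 < \<epsilon>" "\<epsilon> < 1"
    and iso: "\<And>S. S \<subseteq> V \<Longrightarrow> real (card S) \<le> k \<Longrightarrow> d * real (card S) \<le> real (edge_boundary E S)"
  shows "1 - (k / 2 + 2) * exp (- (\<epsilon>\<^sup>2 * (1 - \<epsilon>) / 4 * k)) \<le>
    measure_pmf.prob (percolation E ((1 + \<epsilon>) / d))
      {F. \<exists>C \<in> component_sets V F. k / 2 \<le> real (card C)}"
    (is "1 - ?\<delta> \<le> measure_pmf.prob (percolation E ?p) ?good")
proof -
  have finV: "finite V" and E2: "\<forall>e\<in>E. card e = 2" and EV: "\<Union>E \<subseteq> V"
    using G(1) by (auto simp: simple_graph_def)
  have finE: "finite E"
    using finV EV by (meson finite_UnionD finite_subset)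
  obtain vs where vs: "set vs = V" "distinct vs"
    using finite_distinct_list[OF finV] by blast
  let ?R = "\<lambda>i F. connected_in F `` set (take i vs)" and ?m = "nat \<lceil>k / 2\<rceil>"
  have RV: "?R i F \<subseteq> V" if "F \<subseteq> E" for i F
    using that EV vs(1) set_take_subset[of i vs] by (intro reach_subset) auto
  have good: "F \<in> ?good" if "F \<subseteq> E"
    "\<And>i. i \<le> ?m \<Longrightarrow> \<not> (k / 2 \<le> real (card (?R i F)) \<and> real (card (?R i F)) \<le> k)" for F
    using large_component_of_reach_gap[OF finV vs(2,1) k G(2) _ that(2)] that(1) EV by blast
  show ?thesis
  proof (cases "1 \<le> ?p")
    case True
    have "E \<in> ?good"
    proof (rule good)
      fix i
      show "\<not> (k / 2 \<le> real (card (?R i E)) \<and> real (card (?R i E)) \<le> k)"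
      proof
        assume *: "k / 2 \<le> real (card (?R i E)) \<and> real (card (?R i E)) \<le> k"
        have "edge_boundary E (?R i E) = 0"
          by (intro edge_boundary_eq_0_of_closed E2) (rule reach_closed)
        then have "d * real (card (?R i E)) \<le> 0"
          using iso[OF RV[of E i]] * by simp
        then show False
          using * k d by (simp add: mult_le_0_iff)
      qed
    qed simp
    then have "measure_pmf.prob (percolation E ?p) ?good = 1"
      using percolation_ge_1[OF finE True] by simp
    then show ?thesis
      using k by simp
  next
    case False
    let ?M = "percolation E ?p"
    let ?B = "\<lambda>i. {F. k / 2 \<le> real (card (?R i F)) \<and> real (card (?R i F)) \<le> k}"
    have "measure_pmf.prob ?M (?B i) \<le> exp (- (\<epsilon>\<^sup>2 * (1 - \<epsilon>) / 2 * (k / 2)))" for i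
      using False d \<epsilon> by (intro prob_reach_medium_le[where d = d] finE E2 iso RV) auto
    then have B: "measure_pmf.prob ?M (?B i) \<le> exp (- (\<epsilon>\<^sup>2 * (1 - \<epsilon>) / 4 * k))" for i
      by simp
    have "1 - measure_pmf.prob ?M ?good = measure_pmf.prob ?M (- ?good)"
      using measure_pmf.prob_compl[of ?good ?M] by (simp add: Compl_eq_Diff_UNIV)
    also have "\<dots> \<le> measure_pmf.prob ?M (\<Union>i\<le>?m. ?B i)"
    proof (intro measure_pmf.finite_measure_mono_AE)
      show "AE F in ?M. F \<in> - ?good \<longrightarrow> F \<in> (\<Union>i\<le>?m. ?B i)"
        unfolding AE_measure_pmf_iff
        using good set_pmf_percolation_subset[OF finE, of ?p] by blast
    qed simp
    also have "\<dots> \<le> (\<Sum>i\<le>?m. measure_pmf.prob ?M (?B i))"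
      by (intro measure_pmf.finite_measure_subadditive_finite) auto
    also have "\<dots> \<le> real (card {..?m}) * exp (- (\<epsilon>\<^sup>2 * (1 - \<epsilon>) / 4 * k))"
      by (intro sum_bounded_above B)
    also have "\<dots> \<le> ?\<delta>"
      using k by (intro mult_right_mono) (simp, linarith, simp)
    finally show ?thesis
      by simp
  qed
qed

theorem theorem1p5:
  "\<exists>\<epsilon>0>0. \<forall>\<epsilon>::real. 0 < \<epsilon> \<and> \<epsilon> < \<epsilon>0 \<longrightarrow>
     (\<forall>(k :: nat \<Rightarrow> real) (d :: nat \<Rightarrow> real) (V :: nat \<Rightarrow> 'a set) (E :: nat \<Rightarrow> 'a set set).
        filterlim k at_top sequentially \<longrightarrow>
        (\<forall>n. 0 < d n \<and> d n \<le> k n) \<longrightarrow>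
        (\<forall>n. simple_graph (V n) (E n) \<and> k n < real (card (V n))) \<longrightarrow>
        (\<forall>n. \<forall>S. S \<subseteq> V n \<and> real (card S) \<le> k n \<longrightarrow>
           d n * real (card S) \<le> real (edge_boundary (E n) S)) \<longrightarrow>
        (\<lambda>n. measure_pmf.prob (percolation (E n) ((1 + \<epsilon>) / d n))
               {F. \<exists>C \<in> component_sets (V n) F. k n / 2 \<le> real (card C)})
          \<longlonglongrightarrow> 1)"
proof (intro exI[of _ 1] conjI allI impI)
  fix \<epsilon> :: real and k d :: "nat \<Rightarrow> real" and V :: "nat \<Rightarrow> 'a set" and E :: "nat \<Rightarrow> 'a set set"
  assume \<epsilon>: "0 < \<epsilon> \<and> \<epsilon> < 1"
    and k: "filterlim k at_top sequentially"
    and d: "\<forall>n. 0 < d n \<and> d n \<le> k n"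
    and G: "\<forall>n. simple_graph (V n) (E n) \<and> k n < real (card (V n))"
    and iso: "\<forall>n. \<forall>S. S \<subseteq> V n \<and> real (card S) \<le> k n \<longrightarrow>
           d n * real (card S) \<le> real (edge_boundary (E n) S)"
  define c where "c = \<epsilon>\<^sup>2 * (1 - \<epsilon>) / 4"
  have "0 < c" using \<epsilon> by (simp add: c_def)
  then have "((\<lambda>t. 1 - (t / 2 + 2) * exp (- (c * t))) \<longlongrightarrow> 1) at_top"
    by real_asymp
  then have lower: "(\<lambda>n. 1 - (k n / 2 + 2) * exp (- (c * k n))) \<longlonglongrightarrow> 1"
    using k by (rule filterlim_compose)
  show "(\<lambda>n. measure_pmf.prob (percolation (E n) ((1 + \<epsilon>) / d n))
               {F. \<exists>C \<in> component_sets (V n) F. k n / 2 \<le> real (card C)}) \<longlonglongrightarrow> 1"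
  proof (rule tendsto_sandwich[OF _ _ lower tendsto_const])
    have "0 < k n" for n
      using d by (meson less_le_trans)
    then show "\<forall>\<^sub>F n in sequentially. 1 - (k n / 2 + 2) * exp (- (c * k n)) \<le>
        measure_pmf.prob (percolation (E n) ((1 + \<epsilon>) / d n))
          {F. \<exists>C \<in> component_sets (V n) F. k n / 2 \<le> real (card C)}"
      unfolding c_def using d G iso \<epsilon>
      by (intro always_eventually allI prob_large_component_ge) auto
  qed simp
qed simp

end
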